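(* Let $p$ be a prime and $r\ge 1$ an integer. Then, in $\overline{\mathbb{F}}_p[X,Y,Z]$, $$T_{p^{2r}-1,\,p^r-1}(X,Y,Z)=\prod_{\substack{\alpha,\beta\in\mathbb{F}_{p^r}\\ \alpha,\beta\neq 0}}\bigl(Z-\alpha X-\beta Y\bigr).$$
   Context: $\overline{\mathbb{F}}_p$ is an algebraic closure of $\mathbb{F}_p$ and $\mathbb{F}_{p^r}\subset\overline{\mathbb{F}}_p$ is its subfield with $p^r$ elements. For integers $A>B>0$ with $d=\gcd(A,B)$, $T_{A,B}(X,Y,Z)=\dfrac{R_{A,B}(X,Y,Z)}{V(X^d,Y^d,Z^d)}$, where $R_{A,B}(X,Y,Z)=\det\begin{pmatrix} X^{A} & Y^{A} & Z^{A}\\ X^{B} & Y^{B} & Z^{B}\\ 1&1&1\end{pmatrix}$ and $V(X,Y,Z)=(X-Y)(Z-X)(Z-Y)$; this quotient is a polynomial. *)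

theory Defs
  imports
    "HOL-Analysis.Determinants"
    "HOL-Algebra.Algebraic_Closure_Type"
begin

text \<open>
  The ring \<open>F[X,Y,Z]\<close> over a field \<open>F\<close> of type \<^typ>\<open>'a\<close> is rendered as the iterated
  polynomial ring \<open>F[X][Y][Z]\<close>, i.e. \<^typ>\<open>'a poly poly poly\<close>, with \<open>Z\<close> the outermost variable.
\<close>

definition const3 :: "'a::field \<Rightarrow> 'a poly poly poly" where
  "const3 c = [:[:[:c:]:]:]"

definition varX :: "'a::field poly poly poly" where
  "varX = [:[:[:0, 1:]:]:]"

definition varY :: "'a::field poly poly poly" where
  "varY = [:[:0, 1:]:]"

definition varZ :: "'a::field poly poly poly" where
  "varZ = [:0, 1:]"

definition detR :: "nat \<Rightarrow> nat \<Rightarrow> 'b \<Rightarrow> 'b \<Rightarrow> 'b \<Rightarrow> 'b::comm_ring_1" where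
  "detR A B x y z =
     det (vector [vector [x ^ A, y ^ A, z ^ A],
                  vector [x ^ B, y ^ B, z ^ B],
                  vector [1, 1, 1]] :: 'b ^ 3 ^ 3)"

definition vdmV :: "'b \<Rightarrow> 'b \<Rightarrow> 'b \<Rightarrow> 'b::comm_ring_1" where
  "vdmV x y z = (x - y) * (z - x) * (z - y)"

text \<open>
  \<open>polyT A B\<close> is meant for \<open>A > B > 0\<close>. The division below is then exact, see \<open>polyT_times_vdmV\<close>.
\<close>

definition polyT :: "nat \<Rightarrow> nat \<Rightarrow> 'a::field poly poly poly" where
  "polyT A B =
     detR A B varX varY varZ
       div vdmV (varX ^ gcd A B) (varY ^ gcd A B) (varZ ^ gcd A B)"

lemma detR_expand:
  "detR A B x y z =
     (x ^ A - z ^ A) * (y ^ B - z ^ B) - (y ^ A - z ^ A) * (x ^ B - z ^ B)"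
  by (simp add: detR_def det_3 vector_def algebra_simps)

lemma vdmV_dvd_detR_aux: "vdmV x y z dvd detR a b x y (z :: 'b::comm_ring_1)"
proof -
  define h where "h n u = (\<Sum>i<n. u ^ i * z ^ (n - Suc i))" for n and u :: 'b
  have h: "u ^ n - z ^ n = (u - z) * h n u" for n u
    by (simp add: h_def power_diff_sumr2 mult.commute[of "u ^ _"])
  have dvd: "x - y dvd h n x - h n y" for n
    unfolding h_def sum_subtractf[symmetric] left_diff_distrib[symmetric]
    by (intro dvd_sum dvd_mult2) (simp add: power_diff_sumr2)
  obtain s t where "h a x - h a y = (x - y) * s" "h b x - h b y = (x - y) * t"
    using dvd[of a] dvd[of b] by (auto simp: dvd_def)
  then have st: "h a x = h a y + (x - y) * s" "h b x = h b y + (x - y) * t"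
    by (metis diff_add_cancel add.commute)+
  have "detR a b x y z = vdmV x y z * (s * h b y - t * h a y)"
    unfolding detR_expand h vdmV_def st by (simp add: algebra_simps)
  then show ?thesis by simp
qed

lemma vdmV_dvd_detR:
  fixes x y z :: "'b::comm_ring_1"
  shows "vdmV (x ^ gcd A B) (y ^ gcd A B) (z ^ gcd A B) dvd detR A B x y z"
proof -
  obtain a b where "A = gcd A B * a" "B = gcd A B * b"
    by (meson dvd_def gcd_dvd1 gcd_dvd2)
  then have "detR A B x y z = detR a b (x ^ gcd A B) (y ^ gcd A B) (z ^ gcd A B)"
    unfolding detR_expand by (simp flip: power_mult)
  then show ?thesis by (simp add: vdmV_dvd_detR_aux)
qed

lemma polyT_times_vdmV:
  "polyT A B * vdmV (varX ^ gcd A B) (varY ^ gcd A B) (varZ ^ gcd A B) = detR A B varX varY varZ"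
  unfolding polyT_def by (simp add: vdmV_dvd_detR)

end

(* Put q = p^r. Multiplying R_{q^2-1,q-1} by XYZ gives the Moore determinant of (X, Y, Z), which is an
   F_q-linear function of Z vanishing at Z = X and Z = Y, hence at the q^2 points a X + b Y with a, b
   in F_q. Its degree in Z is q^2 and its leading coefficient is X Y (X^(q-1) - Y^(q-1)), so it is
   this coefficient times the product of all Z - a X - b Y. The factors with a = 0 or b = 0 multiply
   to Z (Z^(q-1) - X^(q-1)) (Z^(q-1) - Y^(q-1)), so cancelling XYZ and V leaves the factors with a, b
   nonzero. *)
theory Submission
  imports Defs
begin

text \<open>Both sides have degree at most \<open>card A\<close>, share the coefficient of that
  index, and vanish at the \<open>card A\<close> distinct points \<open>s a\<close>. Their
  difference has more roots than its degree allows.\<close>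

lemma poly_eq_smult_prod_roots:
  fixes f :: "'b::idom poly" and s :: "'c \<Rightarrow> 'b"
  assumes "finite A" and inj: "inj_on s A" and deg: "Polynomial.degree f \<le> card A"
    and root: "\<And>a. a \<in> A \<Longrightarrow> poly f (s a) = 0"
  shows "f = Polynomial.smult (poly.coeff f (card A)) (\<Prod>a\<in>A. [:- s a, 1:])"
proof -
  let ?P = "\<Prod>a\<in>A. [:- s a, 1:]"
  have dP: "Polynomial.degree ?P = card A"
    by (subst degree_prod_eq_sum_degree) auto
  have lP: "poly.coeff ?P (card A) = 1"
    using lead_coeff_prod[of "\<lambda>a. [:- s a, 1:]" A] dP by simp
  show ?thesis
  proof (rule poly_eqI_degree_lead_coeff[where n = "card A" and A = "s ` A"])
    show "Polynomial.degree (Polynomial.smult (poly.coeff f (card A)) ?P) \<le> card A"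
      by (rule order_trans[OF degree_smult_le]) (simp add: dP)
    show "poly f z = poly (Polynomial.smult (poly.coeff f (card A)) ?P) z" if "z \<in> s ` A" for z
      using that root \<open>finite A\<close> by (auto simp: poly_prod)
  qed (use deg inj lP in \<open>auto simp: card_image\<close>)
qed

text \<open>Translation by 1 permutes \<open>F\<close>, so the sum over \<open>F\<close> equals
  itself plus \<open>card F\<close>.\<close>

lemma of_nat_card_add_closed_eq_0:
  fixes F :: "'a::comm_ring_1 set"
  assumes "finite F" "1 \<in> F" "\<And>x y. x \<in> F \<Longrightarrow> y \<in> F \<Longrightarrow> x + y \<in> F"
  shows "of_nat (card F) = (0::'a)"
proof -
  have inj: "inj_on (\<lambda>x. x + 1) F"
    by (simp add: inj_on_def)
  then have "(\<lambda>x. x + 1) ` F = F"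
    using assms by (intro card_subset_eq) (auto simp: card_image)
  then have "sum id F = (\<Sum>x\<in>F. x + 1)"
    using sum.reindex[OF inj, of id] by simp
  then show ?thesis
    by (simp add: sum.distrib)
qed

text \<open>Multiplication by \<open>x\<close> permutes the nonzero elements; compare their products
  and cancel.\<close>

lemma power_card_mult_closed_eq_1:
  fixes F :: "'a::idom set"
  assumes "finite F" "\<And>x y. x \<in> F \<Longrightarrow> y \<in> F \<Longrightarrow> x * y \<in> F" "x \<in> F" "x \<noteq> 0"
  shows "x ^ card (F - {0}) = 1"
proof -
  let ?G = "F - {0}"
  have inj: "inj_on ((*) x) ?G"
    using assms by (simp add: inj_on_def)
  then have "(*) x ` ?G = ?G"
    using assms by (intro card_subset_eq) (auto simp: card_image)
  then have "prod id ?G = (\<Prod>y\<in>?G. x * y)"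
    using prod.reindex[OF inj, of id] by simp
  also have "\<dots> = x ^ card ?G * prod id ?G"
    by (simp add: prod.distrib)
  finally show ?thesis
    using assms(1) by (simp add: id_def)
qed

text \<open>Multiplying the columns by \<open>x\<close>, \<open>y\<close>, \<open>z\<close> raises
  every exponent by one; the right side expands the resulting determinant along the \<open>z\<close>
  column. With \<open>Suc A = q ^ 2\<close> and \<open>Suc B = q\<close> it is the Moore
  determinant.\<close>

lemma mult_detR_eq_moore:
  fixes x y z :: "'b::comm_ring_1"
  shows "x * y * z * detR A B x y z =
    (x ^ Suc B * y - x * y ^ Suc B) * z ^ Suc A
    - (x ^ Suc A * y - x * y ^ Suc A) * z ^ Suc B
    + (x ^ Suc A * y ^ Suc B - x ^ Suc B * y ^ Suc A) * z"
  unfolding detR_expand by (simp add: algebra_simps)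

text \<open>The values \<open>k a * w\<close> are \<open>card G\<close> distinct roots of the monic
  polynomial \<open>Z^n - w^n\<close> with \<open>n = card G\<close>. For empty \<open>G\<close> the
  right side would be 0 and the product 1.\<close>

lemma prod_linear_roots_of_unity:
  fixes w :: "'b::idom" and k :: "'a \<Rightarrow> 'b"
  assumes "finite G" "G \<noteq> {}" "inj_on k G" "\<And>a. a \<in> G \<Longrightarrow> k a ^ card G = 1" "w \<noteq> 0"
  shows "(\<Prod>a\<in>G. [:- (k a * w), 1:]) = [:0, 1:] ^ card G - [:w:] ^ card G"
proof -
  let ?f = "Polynomial.monom 1 (card G) - [:w ^ card G:]"
  have "?f = Polynomial.smult (poly.coeff ?f (card G)) (\<Prod>a\<in>G. [:- (k a * w), 1:])"
  proof (rule poly_eq_smult_prod_roots)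
    show "inj_on (\<lambda>a. k a * w) G"
      using assms by (simp add: inj_on_def)
    show "Polynomial.degree ?f \<le> card G"
      by (intro degree_diff_le) (auto simp: degree_monom_le)
  qed (use assms in \<open>auto simp: poly_monom power_mult_distrib\<close>)
  moreover have "poly.coeff ?f (card G) = 1"
    using assms by (simp add: card_gt_0_iff coeff_pCons split: nat.split)
  ultimately have "?f = (\<Prod>a\<in>G. [:- (k a * w), 1:])"
    by (metis smult_1_left)
  then show ?thesis
    by (simp add: monom_altdef poly_const_pow)
qed

lemma prod_split_zero_square:
  fixes g :: "'a::zero \<Rightarrow> 'a \<Rightarrow> 'b::comm_monoid_mult"
  assumes "finite F" "0 \<in> F"
  shows "(\<Prod>(a, b)\<in>F \<times> F. g a b) =
    g 0 0 * (\<Prod>a\<in>F - {0}. g a 0) * (\<Prod>b\<in>F - {0}. g 0 b) *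
    (\<Prod>(a, b)\<in>(F - {0}) \<times> (F - {0}). g a b)"
  using assms by (simp add: prod.cartesian_product[symmetric] prod.remove[of F 0] prod.distrib mult_ac)

theorem mainTheorem6:
  fixes p r :: nat and Fp Fq :: "'a::field set"
  assumes "prime p"
    and "r \<ge> 1"
    and "algebraic_closure (ring_of_type_algebra :: 'a ring) Fp"
    and "card Fp = p"
    and "subfield Fq (ring_of_type_algebra :: 'a ring)"
    and "card Fq = p ^ r"
  shows "(polyT (p ^ (2 * r) - 1) (p ^ r - 1) :: 'a poly poly poly) =
    (\<Prod>(\<alpha>, \<beta>) \<in> (Fq - {0}) \<times> (Fq - {0}). varZ - const3 \<alpha> * varX - const3 \<beta> * varY)"
proof -
  define q where "q = p ^ r"
  define A where "A = q ^ 2 - 1"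
  define B where "B = q - 1"
  have "q > 1"
    using assms(1,2) unfolding q_def by (intro one_less_power prime_gt_1_nat) auto
  then have SA: "Suc A = q ^ 2" and SB: "Suc B = q" and "B > 0"
    by (simp_all add: A_def B_def)
  \<comment> \<open>Hence the denominator in \<open>polyT A B\<close> is the Vandermonde product at
    \<open>B\<close>-th powers.\<close>
  have "A = B * (q + 1)"
    using SA unfolding SB[symmetric] by (simp add: power2_eq_square)
  then have gcd: "gcd A B = B"
    by simp
  have fin: "finite Fq"
    using assms(6) \<open>q > 1\<close> by (metis card.infinite not_one_less_zero q_def)

  have sub: "subring Fq (ring_of_type_algebra :: 'a ring)"
    using assms(5) by (rule subfieldE)
  have add: "x + y \<in> Fq" and mult: "x * y \<in> Fq" if "x \<in> Fq" "y \<in> Fq" for x y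
    using subringE[OF sub] that by (auto simp: ring_of_type_algebra_def)
  have zero: "0 \<in> Fq" and one: "1 \<in> Fq"
    using subringE[OF sub] by (auto simp: ring_of_type_algebra_def)

  \<comment> \<open>The size of \<open>Fq\<close> is zero in the field, so the prime
    \<open>p\<close> is zero there and must be the characteristic.\<close>
  have "of_nat (p ^ r) = (0::'a)"
    using of_nat_card_add_closed_eq_0[OF fin one add] assms(6) by simp
  then have "CHAR('a) dvd p"
    by (simp add: of_nat_eq_0_iff_char_dvd[symmetric])
  then have char: "CHAR('a) = p"
    using assms(1) of_nat_eq_0_iff_char_dvd[of 1, where 'a = 'a] by (auto simp: prime_nat_iff)
  have cardG: "card (Fq - {0}) = B"
    using fin zero assms(6) by (simp add: B_def q_def)
  have unity: "a ^ B = 1" if "a \<in> Fq" "a \<noteq> 0" for a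
    using power_card_mult_closed_eq_1[OF fin mult] that cardG by simp
  have frob: "a ^ q = a" if "a \<in> Fq" for a
    using unity[OF that] \<open>q > 1\<close> by (cases "a = 0") (simp_all flip: SB)

  \<comment> \<open>Here \<open>x\<close> and \<open>y\<close> live in the coefficient ring, so the
    determinant can be read as a polynomial in Z alone, with candidate roots \<open>L c\<close> in
    that ring.\<close>
  define x y :: "'a poly poly" where "x = [:[:0, 1:]:]" and "y = [:0, 1:]"
  define k :: "'a \<Rightarrow> 'a poly poly" where "k a = [:[:a:]:]" for a
  define z :: "'a poly poly poly" where "z = [:0, 1:]"
  define L where "L c = k (fst c) * x + k (snd c) * y" for c
  have vars: "varX = [:x:]" "varY = [:y:]" "varZ = z" "const3 a = [:k a:]" for a
    by (simp_all add: varX_def varY_def varZ_def const3_def x_def y_def z_def k_def)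
  have nz: "x \<noteq> 0" "y \<noteq> 0" "z \<noteq> 0"
    by (simp_all add: x_def y_def z_def)
  have k_pow: "k a ^ n = k (a ^ n)" for a n
    by (simp add: k_def poly_const_pow)
  have k_inj: "inj_on k S" for S
    by (simp add: inj_on_def k_def)
  have L_inj: "inj_on L S" for S
    by (auto simp: inj_on_def L_def k_def x_def y_def)
  \<comment> \<open>The \<open>q\<close>-th power map is additive in characteristic \<open>p\<close>
    and fixes \<open>Fq\<close>, hence is \<open>Fq\<close>-linear.\<close>
  have L_frob: "(k a * s + k b * t) ^ q = k a * s ^ q + k b * t ^ q"
    if "a \<in> Fq" "b \<in> Fq" for a b s t
    using freshmans_dream'[of q r "k a * s" "k b * t"] assms(1) that
    by (simp add: char q_def[symmetric] power_mult_distrib k_pow frob)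

  define M where "M = Polynomial.monom (x ^ q * y - x * y ^ q) (q ^ 2)
    - Polynomial.monom (x ^ q\<^sup>2 * y - x * y ^ q\<^sup>2) q
    + Polynomial.monom (x ^ q\<^sup>2 * y ^ q - x ^ q * y ^ q\<^sup>2) 1"
  have M_detR: "[:x:] * [:y:] * z * detR A B [:x:] [:y:] z = M"
    unfolding mult_detR_eq_moore SA SB M_def z_def
    by (simp add: monom_altdef poly_const_pow mult.commute)
  \<comment> \<open>By linearity, the powers of \<open>L c\<close> with exponents 1,
    \<open>q\<close> and \<open>q ^ 2\<close> are one and the same combination of those of
    \<open>x\<close> and \<open>y\<close>, so the columns of the Moore determinant become
    dependent.\<close>
  have M_root: "poly M (L c) = 0" if mem: "c \<in> Fq \<times> Fq" for c
  proof -
    obtain a b where c: "c = (a, b)" "a \<in> Fq" "b \<in> Fq"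
      using mem by auto
    have 1: "L c ^ q = k a * x ^ q + k b * y ^ q"
      using L_frob c by (simp add: L_def)
    have "L c ^ q\<^sup>2 = (L c ^ q) ^ q"
      by (simp add: power2_eq_square power_mult)
    also have "\<dots> = k a * x ^ q\<^sup>2 + k b * y ^ q\<^sup>2"
      unfolding 1 using L_frob c by (simp add: power2_eq_square power_mult)
    finally have 2: "L c ^ q\<^sup>2 = k a * x ^ q\<^sup>2 + k b * y ^ q\<^sup>2" .
    have 3: "L c = k a * x + k b * y"
      by (simp add: L_def c)
    have "poly M (L c) = (x ^ q * y - x * y ^ q) * L c ^ q\<^sup>2
      - (x ^ q\<^sup>2 * y - x * y ^ q\<^sup>2) * L c ^ q + (x ^ q\<^sup>2 * y ^ q - x ^ q * y ^ q\<^sup>2) * L c"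
      by (simp add: M_def poly_monom)
    also have "\<dots> = 0"
      unfolding 1 2 unfolding 3 by (simp add: algebra_simps)
    finally show ?thesis .
  qed
  have qq: "q < q\<^sup>2" "card (Fq \<times> Fq) = q\<^sup>2"
    using \<open>q > 1\<close> assms(6) by (simp_all add: card_cartesian_product power2_eq_square flip: q_def)
  have "M = Polynomial.smult (poly.coeff M (card (Fq \<times> Fq))) (\<Prod>c\<in>Fq \<times> Fq. [:- L c, 1:])"
  proof (rule poly_eq_smult_prod_roots)
    show "Polynomial.degree M \<le> card (Fq \<times> Fq)"
      unfolding M_def qq
      by (intro degree_add_le degree_diff_le order_trans[OF degree_monom_le])
        (use qq \<open>q > 1\<close> in auto)
  qed (use fin L_inj M_root in auto)
  \<comment> \<open>Only the first monomial of \<open>M\<close> contributes, since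
    \<open>1 < q < q ^ 2\<close>.\<close>
  moreover have "poly.coeff M (card (Fq \<times> Fq)) = x * y * (x ^ B - y ^ B)"
    using qq \<open>q > 1\<close> by (simp add: M_def algebra_simps flip: SB)
  ultimately have M_prod: "M = [:x * y * (x ^ B - y ^ B):] * (\<Prod>c\<in>Fq \<times> Fq. [:- L c, 1:])"
    by simp

  define P where "P = (\<Prod>(a, b)\<in>(Fq - {0}) \<times> (Fq - {0}). [:- L (a, b), 1:])"
  have G: "finite (Fq - {0})" "Fq - {0} \<noteq> {}"
    using fin one by auto
  have k01: "k 0 = 0" "k 1 = 1"
    by (simp_all add: k_def one_pCons)
  \<comment> \<open>Used with \<open>w = x\<close> and \<open>w = y\<close> for the roots with
    exactly one nonzero coordinate.\<close>
  have line: "(\<Prod>a\<in>Fq - {0}. [:- (k a * w), 1:]) = z ^ B - [:w:] ^ B" if "w \<noteq> 0" for w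
    using prod_linear_roots_of_unity[OF G k_inj _ that] cardG
    by (simp add: z_def k_pow unity k01)
  have "(\<Prod>c\<in>Fq \<times> Fq. [:- L c, 1:]) = (\<Prod>(a, b)\<in>Fq \<times> Fq. [:- L (a, b), 1:])"
    by (simp add: case_prod_beta)
  also have "\<dots> = z * (z ^ B - [:x:] ^ B) * (z ^ B - [:y:] ^ B) * P"
    unfolding prod_split_zero_square[OF fin zero] P_def
    by (simp add: L_def k01 line nz z_def[symmetric])
  finally have all: "(\<Prod>c\<in>Fq \<times> Fq. [:- L c, 1:]) = \<dots>" .

  have lead: "[:x * y * (x ^ B - y ^ B):] = [:x:] * [:y:] * ([:x:] ^ B - [:y:] ^ B)"
    by (simp add: poly_const_pow mult_ac)
  \<comment> \<open>The three factors of \<open>?V\<close> are, up to order, the difference in the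
    leading coefficient and the two axis products.\<close>
  let ?W = "[:x:] * [:y:] * z" and ?V = "vdmV ([:x:] ^ B) ([:y:] ^ B) (z ^ B)"
  have "?W * ?V * polyT A B = ?W * detR A B [:x:] [:y:] z"
    using polyT_times_vdmV[of A B, where 'a = 'a] by (simp add: gcd vars mult_ac)
  also have "\<dots> = ?W * ?V * P"
    unfolding M_detR M_prod all vdmV_def lead by (simp only: mult_ac)
  finally have "?W * ?V * polyT A B = ?W * ?V * P" .
  moreover have "?W * ?V \<noteq> 0"
  proof -
    \<comment> \<open>Setting Y = 0 kills \<open>y ^ B\<close>, as \<open>B > 0\<close>, but not
      \<open>x ^ B\<close>, which is constant in Y. Setting Z = 0 likewise separates
      \<open>z ^ B\<close> from \<open>[:w:] ^ B\<close> below.\<close>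
    have "x ^ B \<noteq> y ^ B"
    proof
      assume "x ^ B = y ^ B"
      then have "poly (x ^ B) 0 = poly (y ^ B) 0"
        by simp
      then show False
        using \<open>B > 0\<close> by (simp add: x_def y_def poly_power power_0_left)
    qed
    moreover have "z ^ B \<noteq> [:w:] ^ B" if "w \<noteq> 0" for w
    proof
      assume "z ^ B = [:w:] ^ B"
      then have "poly (z ^ B) 0 = poly ([:w:] ^ B) 0"
        by simp
      then show False
        using \<open>B > 0\<close> that by (simp add: z_def poly_power power_0_left)
    qed
    ultimately show ?thesis
      using nz by (simp add: vdmV_def poly_const_pow)
  qed
  ultimately have "polyT A B = P"
    by (simp only: mult_cancel_left) simp
  moreover have "P = (\<Prod>(\<alpha>, \<beta>) \<in> (Fq - {0}) \<times> (Fq - {0}). varZ - const3 \<alpha> * varX - const3 \<beta> * varY)"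
    unfolding P_def by (intro prod.cong) (auto simp: vars L_def z_def)
  moreover have "p ^ (2 * r) - 1 = A" "p ^ r - 1 = B"
    by (simp_all add: A_def B_def q_def power_mult mult.commute flip: power_mult)
  ultimately show ?thesis
    by simp
qed

end
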